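(* Let $\mathbb{C}$ be a centralic category. The full subcategory $\mathsf{Com}(\mathbb{C})$ of commutative objects in $\mathbb{C}$ is equivalent to the category $\mathsf{CMon}(\mathbb{C})$ of internal commutative monoids in $\mathbb{C}$.
   Context: A pointed category is a category with a zero object $0$; zero morphisms are also denoted $0$. For morphisms $x\colon S\to X$, $y\colon S\to Y$, $f\colon X\times Y\to Z$, write $f(x,y)$ for the composite $f\circ(x,y)\colon S\to Z$. A pointed category with finite products is called centralic if for every morphism $f\colon X\times Y\to Z$, every object $S$ and all morphisms $x,x'\colon S\to X$, $y\colon S\to Y$: $f(x,0)=f(x',0)$ implies $f(x,y)=f(x',y)$. An object $X$ is commutative if there is a morphism $\rho\colon X\times X\to X$ with $\rho\circ(1_X,0)=1_X=\rho\circ(0,1_X)$. The morphisms of $\mathsf{CMon}(\mathbb{C})$ are the internal monoid homomorphisms. *)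

theory Defs
  imports Main
begin

section \<open>Categories\<close>

record ('o, 'm) cat =
  Obj :: "'o set"
  Arr :: "'m set"
  Dom :: "'m \<Rightarrow> 'o"
  Cod :: "'m \<Rightarrow> 'o"
  Ident :: "'o \<Rightarrow> 'm"
  Comp :: "'m \<Rightarrow> 'm \<Rightarrow> 'm"  (infixr "\<cdot>\<index>" 70)

definition hom :: "('o, 'm) cat \<Rightarrow> 'o \<Rightarrow> 'o \<Rightarrow> 'm set" where
  "hom C X Y = {f \<in> Arr C. Dom C f = X \<and> Cod C f = Y}"

locale category =
  fixes C :: "('o, 'm) cat" (structure)
  assumes Dom_in_Obj: "f \<in> Arr C \<Longrightarrow> Dom C f \<in> Obj C"
    and Cod_in_Obj: "f \<in> Arr C \<Longrightarrow> Cod C f \<in> Obj C"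
    and Ident_in_hom: "X \<in> Obj C \<Longrightarrow> Ident C X \<in> hom C X X"
    and Comp_in_hom: "\<lbrakk>f \<in> hom C X Y; g \<in> hom C Y Z\<rbrakk> \<Longrightarrow> g \<cdot> f \<in> hom C X Z"
    and Comp_assoc:
      "\<lbrakk>f \<in> hom C W X; g \<in> hom C X Y; h \<in> hom C Y Z\<rbrakk> \<Longrightarrow> (h \<cdot> g) \<cdot> f = h \<cdot> (g \<cdot> f)"
    and Comp_Ident_right: "f \<in> hom C X Y \<Longrightarrow> f \<cdot> Ident C X = f"
    and Comp_Ident_left: "f \<in> hom C X Y \<Longrightarrow> Ident C Y \<cdot> f = f"

definition is_iso :: "('o, 'm) cat \<Rightarrow> 'o \<Rightarrow> 'o \<Rightarrow> 'm \<Rightarrow> bool" where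
  "is_iso C X Y f \<longleftrightarrow> f \<in> hom C X Y \<and>
     (\<exists>g \<in> hom C Y X. g \<cdot>\<^bsub>C\<^esub> f = Ident C X \<and> f \<cdot>\<^bsub>C\<^esub> g = Ident C Y)"

definition full_subcategory :: "('o, 'm) cat \<Rightarrow> 'o set \<Rightarrow> ('o, 'm) cat" where
  "full_subcategory C S = C\<lparr>Obj := Obj C \<inter> S,
     Arr := {f \<in> Arr C. Dom C f \<in> S \<and> Cod C f \<in> S}\<rparr>"


section \<open>Functors and equivalence of categories\<close>

record ('o1, 'm1, 'o2, 'm2) fctor =
  OMap :: "'o1 \<Rightarrow> 'o2"
  AMap :: "'m1 \<Rightarrow> 'm2"

definition is_functor ::
    "('o1, 'm1) cat \<Rightarrow> ('o2, 'm2) cat \<Rightarrow> ('o1, 'm1, 'o2, 'm2) fctor \<Rightarrow> bool" where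
  "is_functor A B F \<longleftrightarrow> category A \<and> category B \<and>
     (\<forall>X \<in> Obj A. OMap F X \<in> Obj B) \<and>
     (\<forall>X \<in> Obj A. \<forall>Y \<in> Obj A. \<forall>f \<in> hom A X Y. AMap F f \<in> hom B (OMap F X) (OMap F Y)) \<and>
     (\<forall>X \<in> Obj A. AMap F (Ident A X) = Ident B (OMap F X)) \<and>
     (\<forall>X \<in> Obj A. \<forall>Y \<in> Obj A. \<forall>Z \<in> Obj A. \<forall>f \<in> hom A X Y. \<forall>g \<in> hom A Y Z.
        AMap F (g \<cdot>\<^bsub>A\<^esub> f) = AMap F g \<cdot>\<^bsub>B\<^esub> AMap F f)"

definition id_functor :: "('o, 'm, 'o, 'm) fctor" where
  "id_functor = \<lparr>OMap = id, AMap = id\<rparr>"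

definition comp_functor ::
    "('o2, 'm2, 'o3, 'm3) fctor \<Rightarrow> ('o1, 'm1, 'o2, 'm2) fctor \<Rightarrow> ('o1, 'm1, 'o3, 'm3) fctor" where
  "comp_functor G F = \<lparr>OMap = OMap G \<circ> OMap F, AMap = AMap G \<circ> AMap F\<rparr>"

definition naturally_isomorphic ::
    "('o1, 'm1) cat \<Rightarrow> ('o2, 'm2) cat \<Rightarrow> ('o1, 'm1, 'o2, 'm2) fctor
      \<Rightarrow> ('o1, 'm1, 'o2, 'm2) fctor \<Rightarrow> bool" where
  "naturally_isomorphic A B F G \<longleftrightarrow> is_functor A B F \<and> is_functor A B G \<and>
     (\<exists>\<tau>. (\<forall>X \<in> Obj A. is_iso B (OMap F X) (OMap G X) (\<tau> X)) \<and>
          (\<forall>X \<in> Obj A. \<forall>Y \<in> Obj A. \<forall>f \<in> hom A X Y.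
             \<tau> Y \<cdot>\<^bsub>B\<^esub> AMap F f = AMap G f \<cdot>\<^bsub>B\<^esub> \<tau> X))"

definition equivalent_categories :: "('o1, 'm1) cat \<Rightarrow> ('o2, 'm2) cat \<Rightarrow> bool" where
  "equivalent_categories A B \<longleftrightarrow>
     (\<exists>F G. is_functor A B F \<and> is_functor B A G \<and>
        naturally_isomorphic A A (comp_functor G F) id_functor \<and>
        naturally_isomorphic B B (comp_functor F G) id_functor)"


section \<open>Zero objects and finite products\<close>

definition initial_object :: "('o, 'm) cat \<Rightarrow> 'o \<Rightarrow> bool" where
  "initial_object C I \<longleftrightarrow> I \<in> Obj C \<and> (\<forall>X \<in> Obj C. \<exists>!f. f \<in> hom C I X)"

definition terminal_object :: "('o, 'm) cat \<Rightarrow> 'o \<Rightarrow> bool" where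
  "terminal_object C T \<longleftrightarrow> T \<in> Obj C \<and> (\<forall>X \<in> Obj C. \<exists>!f. f \<in> hom C X T)"

definition zero_object :: "('o, 'm) cat \<Rightarrow> 'o \<Rightarrow> bool" where
  "zero_object C Z \<longleftrightarrow> initial_object C Z \<and> terminal_object C Z"

definition pointed :: "('o, 'm) cat \<Rightarrow> bool" where
  "pointed C \<longleftrightarrow> category C \<and> (\<exists>Z. zero_object C Z)"

text \<open>The composite does not depend on the zero object it passes through.\<close>

definition zero_mor :: "('o, 'm) cat \<Rightarrow> 'o \<Rightarrow> 'o \<Rightarrow> 'm" where
  "zero_mor C X Y =
     (THE f. \<exists>Z. zero_object C Z \<and> (\<exists>u \<in> hom C X Z. \<exists>v \<in> hom C Z Y. f = v \<cdot>\<^bsub>C\<^esub> u))"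

definition is_product :: "('o, 'm) cat \<Rightarrow> 'o \<Rightarrow> 'o \<Rightarrow> 'o \<times> 'm \<times> 'm \<Rightarrow> bool" where
  "is_product C X Y = (\<lambda>(P, p, q). P \<in> Obj C \<and> p \<in> hom C P X \<and> q \<in> hom C P Y \<and>
     (\<forall>S \<in> Obj C. \<forall>x \<in> hom C S X. \<forall>y \<in> hom C S Y.
        \<exists>!h. h \<in> hom C S P \<and> p \<cdot>\<^bsub>C\<^esub> h = x \<and> q \<cdot>\<^bsub>C\<^esub> h = y))"

definition has_finite_products :: "('o, 'm) cat \<Rightarrow> bool" where
  "has_finite_products C \<longleftrightarrow> category C \<and> (\<exists>T. terminal_object C T) \<and>
     (\<forall>X \<in> Obj C. \<forall>Y \<in> Obj C. \<exists>D. is_product C X Y D)"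

text \<open>
  Having finite products is a property; the terminal object and the binary products
  occurring in the notions below are an arbitrary but fixed choice.
\<close>

definition terminal :: "('o, 'm) cat \<Rightarrow> 'o" where
  "terminal C = (SOME T. terminal_object C T)"

definition to_terminal :: "('o, 'm) cat \<Rightarrow> 'o \<Rightarrow> 'm" where
  "to_terminal C X = (THE f. f \<in> hom C X (terminal C))"

definition product_diagram :: "('o, 'm) cat \<Rightarrow> 'o \<Rightarrow> 'o \<Rightarrow> 'o \<times> 'm \<times> 'm" where
  "product_diagram C X Y = (SOME D. is_product C X Y D)"

definition prd :: "('o, 'm) cat \<Rightarrow> 'o \<Rightarrow> 'o \<Rightarrow> 'o" where
  "prd C X Y = fst (product_diagram C X Y)"

definition proj1 :: "('o, 'm) cat \<Rightarrow> 'o \<Rightarrow> 'o \<Rightarrow> 'm" where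
  "proj1 C X Y = fst (snd (product_diagram C X Y))"

definition proj2 :: "('o, 'm) cat \<Rightarrow> 'o \<Rightarrow> 'o \<Rightarrow> 'm" where
  "proj2 C X Y = snd (snd (product_diagram C X Y))"

definition pairing :: "('o, 'm) cat \<Rightarrow> 'm \<Rightarrow> 'm \<Rightarrow> 'm" where
  "pairing C x y = (THE h. h \<in> hom C (Dom C x) (prd C (Cod C x) (Cod C y)) \<and>
     proj1 C (Cod C x) (Cod C y) \<cdot>\<^bsub>C\<^esub> h = x \<and> proj2 C (Cod C x) (Cod C y) \<cdot>\<^bsub>C\<^esub> h = y)"


section \<open>Centralic categories and commutative objects\<close>

definition centralic :: "('o, 'm) cat \<Rightarrow> bool" where
  "centralic C \<longleftrightarrow> pointed C \<and> has_finite_products C \<and>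
     (\<forall>X \<in> Obj C. \<forall>Y \<in> Obj C. \<forall>Z \<in> Obj C. \<forall>S \<in> Obj C.
      \<forall>f \<in> hom C (prd C X Y) Z. \<forall>x \<in> hom C S X. \<forall>x' \<in> hom C S X. \<forall>y \<in> hom C S Y.
        f \<cdot>\<^bsub>C\<^esub> pairing C x (zero_mor C S Y) = f \<cdot>\<^bsub>C\<^esub> pairing C x' (zero_mor C S Y) \<longrightarrow>
        f \<cdot>\<^bsub>C\<^esub> pairing C x y = f \<cdot>\<^bsub>C\<^esub> pairing C x' y)"

definition commutative_object :: "('o, 'm) cat \<Rightarrow> 'o \<Rightarrow> bool" where
  "commutative_object C X \<longleftrightarrow> X \<in> Obj C \<and>
     (\<exists>\<rho> \<in> hom C (prd C X X) X.
        \<rho> \<cdot>\<^bsub>C\<^esub> pairing C (Ident C X) (zero_mor C X X) = Ident C X \<and>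
        \<rho> \<cdot>\<^bsub>C\<^esub> pairing C (zero_mor C X X) (Ident C X) = Ident C X)"

definition Com :: "('o, 'm) cat \<Rightarrow> ('o, 'm) cat" where
  "Com C = full_subcategory C {X. commutative_object C X}"


section \<open>Internal commutative monoids\<close>

text \<open>
  Associativity is stated on \<open>(X \<times> X) \<times> X\<close>, whose three projections to \<open>X\<close>
  are \<open>a\<close>, \<open>b\<close>, \<open>c\<close>.
\<close>

definition internal_comm_monoid :: "('o, 'm) cat \<Rightarrow> 'o \<times> 'm \<times> 'm \<Rightarrow> bool" where
  "internal_comm_monoid C = (\<lambda>(X, m, e).
     X \<in> Obj C \<and> m \<in> hom C (prd C X X) X \<and> e \<in> hom C (terminal C) X \<and>
     (let a = proj1 C X X \<cdot>\<^bsub>C\<^esub> proj1 C (prd C X X) X;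
          b = proj2 C X X \<cdot>\<^bsub>C\<^esub> proj1 C (prd C X X) X;
          c = proj2 C (prd C X X) X
      in m \<cdot>\<^bsub>C\<^esub> pairing C (m \<cdot>\<^bsub>C\<^esub> pairing C a b) c = m \<cdot>\<^bsub>C\<^esub> pairing C a (m \<cdot>\<^bsub>C\<^esub> pairing C b c)) \<and>
     m \<cdot>\<^bsub>C\<^esub> pairing C (Ident C X) (e \<cdot>\<^bsub>C\<^esub> to_terminal C X) = Ident C X \<and>
     m \<cdot>\<^bsub>C\<^esub> pairing C (e \<cdot>\<^bsub>C\<^esub> to_terminal C X) (Ident C X) = Ident C X \<and>
     m \<cdot>\<^bsub>C\<^esub> pairing C (proj2 C X X) (proj1 C X X) = m)"

definition internal_monoid_hom ::
    "('o, 'm) cat \<Rightarrow> 'o \<times> 'm \<times> 'm \<Rightarrow> 'o \<times> 'm \<times> 'm \<Rightarrow> 'm \<Rightarrow> bool" where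
  "internal_monoid_hom C = (\<lambda>(X, m, e) (Y, n, u) f. f \<in> hom C X Y \<and>
     f \<cdot>\<^bsub>C\<^esub> m = n \<cdot>\<^bsub>C\<^esub> pairing C (f \<cdot>\<^bsub>C\<^esub> proj1 C X X) (f \<cdot>\<^bsub>C\<^esub> proj2 C X X) \<and>
     f \<cdot>\<^bsub>C\<^esub> e = u)"

text \<open>
  One arrow of \<open>C\<close> may be a homomorphism for several monoid structures, so arrows of
  \<open>CMon C\<close> carry their domain and codomain.
\<close>

definition CMon :: "('o, 'm) cat \<Rightarrow>
    ('o \<times> 'm \<times> 'm, ('o \<times> 'm \<times> 'm) \<times> 'm \<times> ('o \<times> 'm \<times> 'm)) cat" where
  "CMon C = \<lparr>
     Obj = {M. internal_comm_monoid C M},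
     Arr = {(M, f, N). internal_comm_monoid C M \<and> internal_comm_monoid C N \<and>
              internal_monoid_hom C M N f},
     Dom = (\<lambda>(M, f, N). M),
     Cod = (\<lambda>(M, f, N). N),
     Ident = (\<lambda>M. (M, Ident C (fst M), M)),
     Comp = (\<lambda>(M', g, N') (M, f, N). (M, g \<cdot>\<^bsub>C\<^esub> f, N'))\<rparr>"

end

theory Submission
  imports Defs
begin

text \<open>
  Call \<open>\<rho> \<colon> X \<times> X \<rightarrow> X\<close> unital if \<open>\<rho>(1, 0) = 1 = \<rho>(0, 1)\<close>, so that an object is commutative
  if it carries some unital operation.  Everything rests on one computation with generalized
  elements.  Let \<open>\<rho>\<close> and \<open>\<sigma>\<close> be unital operations on \<open>X\<close> and \<open>Y\<close>, and let
  \<open>f \<colon> X \<rightarrow> Y\<close> be any morphism.  The morphism \<open>h((u, a), c) = \<sigma>(u, f(\<rho>(a, c)))\<close> on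
  \<open>(Y \<times> X) \<times> X\<close> satisfies
  \<open>h((u, a), 0) = \<sigma>(u, f(a)) = h((\<sigma>(u, f(a)), 0), 0)\<close>, so the centralic axiom allows \<open>0\<close> to be
  replaced by \<open>c\<close> on both sides:
  \<open>\<sigma>(u, f(\<rho>(a, c))) = \<sigma>(\<sigma>(u, f(a)), f(c))\<close>.
  This is lemma \<open>mixed_associativity\<close>.  For \<open>f = 1\<close> and \<open>\<rho> = \<sigma>\<close> it says that unital operations
  are associative.  For \<open>u = 0\<close> it says that every morphism preserves unital operations
  (\<open>unital_op_preserved\<close>); with \<open>f = 1\<close> this gives uniqueness of the unital operation on \<open>X\<close>, and
  uniqueness gives commutativity, because swapping the arguments of a unital operation leaves
  it unital.

  Conversely, the terminal object is a zero object, so the unit of an internal monoid is a zero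
  morphism and the multiplication of an internal monoid is unital.  Hence a commutative object
  carries exactly one internal commutative monoid structure, and all morphisms between
  commutative objects are homomorphisms.  Equipping a commutative object with its structure and
  forgetting the structure are therefore functors that are inverse to each other on the nose,
  and the natural isomorphisms required for an equivalence consist of identities.
\<close>

section \<open>Functors naturally isomorphic to the identity\<close>

lemma (in category) hom_Obj:
  assumes "f \<in> hom C X Y"
  shows "X \<in> Obj C" "Y \<in> Obj C"
  using assms Dom_in_Obj Cod_in_Obj by (auto simp: hom_def)

lemma (in category) Ident_is_iso:
  "X \<in> Obj C \<Longrightarrow> is_iso C X X (Ident C X)"
  unfolding is_iso_def using Ident_in_hom Comp_Ident_left by blast

lemma is_functor_id: "category A \<Longrightarrow> is_functor A A id_functor"
  by (auto simp: is_functor_def id_functor_def)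

lemma is_functor_comp:
  assumes "is_functor A B F" "is_functor B D G"
  shows "is_functor A D (comp_functor G F)"
  using assms unfolding is_functor_def comp_functor_def
  by (simp, intro conjI ballI) metis

lemma naturally_isomorphic_id:
  assumes F: "is_functor A A F"
    and obj: "\<And>X. X \<in> Obj A \<Longrightarrow> OMap F X = X"
    and arr: "\<And>X Y f. f \<in> hom A X Y \<Longrightarrow> AMap F f = f"
  shows "naturally_isomorphic A A F id_functor"
proof -
  interpret category A using F by (simp add: is_functor_def)
  show ?thesis
    unfolding naturally_isomorphic_def
  proof (intro conjI exI[of _ "Ident A"] ballI)
    show "is_functor A A F" by (rule F)
    show "is_functor A A id_functor" by (rule is_functor_id) unfold_locales
    show "is_iso A (OMap F X) (OMap id_functor X) (Ident A X)" if "X \<in> Obj A" for X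
      using Ident_is_iso that obj by (simp add: id_functor_def)
    show "Ident A Y \<cdot>\<^bsub>A\<^esub> AMap F f = AMap id_functor f \<cdot>\<^bsub>A\<^esub> Ident A X"
      if "f \<in> hom A X Y" for X Y f
      using that Comp_Ident_left Comp_Ident_right by (simp add: id_functor_def arr)
  qed
qed


section \<open>Zero morphisms and pairings\<close>

locale pointed_category_with_products = category +
  assumes pointed: "pointed C"
    and finite_products: "has_finite_products C"
begin

lemma terminal_object_terminal: "terminal_object C (terminal C)"
  unfolding terminal_def using finite_products
  by (auto simp: has_finite_products_def intro: someI_ex)

text \<open>
  A terminal object of a pointed category is isomorphic to the zero object, hence initial.
\<close>

lemma zero_object_terminal: "zero_object C (terminal C)"
proof -
  obtain Z where "zero_object C Z" using pointed by (auto simp: pointed_def)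
  then have Z: "initial_object C Z" "Z \<in> Obj C" and tZ: "terminal_object C Z"
    by (auto simp: zero_object_def initial_object_def)
  let ?T = "terminal C"
  have T: "terminal_object C ?T" "?T \<in> Obj C"
    using terminal_object_terminal by (auto simp: terminal_object_def)
  obtain u where u: "u \<in> hom C ?T Z" using tZ T(2) by (auto simp: terminal_object_def)
  obtain v where v: "v \<in> hom C Z ?T" using T(1) Z(2) by (auto simp: terminal_object_def)
  have vu: "v \<cdot> u = Ident C ?T"
    using T Comp_in_hom[OF u v] Ident_in_hom[OF T(2)] unfolding terminal_object_def by blast
  have "\<exists>!f. f \<in> hom C ?T X" if X: "X \<in> Obj C" for X
  proof -
    obtain w where w: "w \<in> hom C Z X" using Z X by (auto simp: initial_object_def)
    have "f = w \<cdot> u" if f: "f \<in> hom C ?T X" for f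
    proof -
      have "f \<cdot> v = w"
        using Z X w Comp_in_hom[OF v f] unfolding initial_object_def by blast
      then show ?thesis
        using Comp_assoc[OF u v f] Comp_Ident_right[OF f] vu by simp
    qed
    then show ?thesis using Comp_in_hom[OF u w] by blast
  qed
  then show ?thesis using T by (simp add: zero_object_def initial_object_def)
qed

text \<open>
  Factorizations through two zero objects are compared along the unique morphism between these.
\<close>

lemma zero_mor_eq:
  assumes Z: "zero_object C Z" and u: "u \<in> hom C X Z" and v: "v \<in> hom C Z Y"
  shows "zero_mor C X Y = v \<cdot> u"
  unfolding zero_mor_def
proof (rule the_equality)
  show "\<exists>Z. zero_object C Z \<and> (\<exists>u'\<in>hom C X Z. \<exists>v'\<in>hom C Z Y. v \<cdot> u = v' \<cdot> u')"
    using assms by blast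
next
  fix f
  assume "\<exists>Z. zero_object C Z \<and> (\<exists>u\<in>hom C X Z. \<exists>v\<in>hom C Z Y. f = v \<cdot> u)"
  then obtain Z' u' v' where Z': "zero_object C Z'" and u': "u' \<in> hom C X Z'"
    and v': "v' \<in> hom C Z' Y" and f: "f = v' \<cdot> u'" by blast
  obtain w where w: "w \<in> hom C Z Z'"
    using Z hom_Obj[OF u'] by (auto simp: zero_object_def initial_object_def)
  have "v' \<cdot> w = v"
    using Z v Comp_in_hom[OF w v'] hom_Obj[OF v]
    unfolding zero_object_def initial_object_def by blast
  moreover have "w \<cdot> u = u'"
    using Z' u' Comp_in_hom[OF u w] hom_Obj[OF u]
    unfolding zero_object_def terminal_object_def by blast
  ultimately show "f = v \<cdot> u" using Comp_assoc[OF u w v'] f by simp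
qed

lemma to_terminal_in_hom: "X \<in> Obj C \<Longrightarrow> to_terminal C X \<in> hom C X (terminal C)"
  unfolding to_terminal_def
  by (rule theI') (use terminal_object_terminal in \<open>simp add: terminal_object_def\<close>)

lemma zero_mor_through_terminal:
  assumes "X \<in> Obj C" and "v \<in> hom C (terminal C) Y"
  shows "v \<cdot> to_terminal C X = zero_mor C X Y"
  using zero_mor_eq[OF zero_object_terminal to_terminal_in_hom] assms by simp

lemma zero_mor_factors:
  assumes "X \<in> Obj C" "Y \<in> Obj C"
  obtains v where "v \<in> hom C (terminal C) Y" "zero_mor C X Y = v \<cdot> to_terminal C X"
  using zero_object_terminal zero_mor_through_terminal assms
  by (metis initial_object_def zero_object_def)

lemma zero_mor_in_hom: "X \<in> Obj C \<Longrightarrow> Y \<in> Obj C \<Longrightarrow> zero_mor C X Y \<in> hom C X Y"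
  by (metis Comp_in_hom to_terminal_in_hom zero_mor_factors)

lemma hom_terminal_eq_zero_mor:
  assumes "e \<in> hom C (terminal C) Y"
  shows "e = zero_mor C (terminal C) Y"
  using assms zero_object_terminal zero_mor_in_hom hom_Obj[OF assms]
  unfolding zero_object_def initial_object_def by blast

lemma Comp_zero_mor:
  assumes X: "X \<in> Obj C" and g: "g \<in> hom C Y Z"
  shows "g \<cdot> zero_mor C X Y = zero_mor C X Z"
proof -
  obtain v where v: "v \<in> hom C (terminal C) Y" "zero_mor C X Y = v \<cdot> to_terminal C X"
    using zero_mor_factors X hom_Obj(1)[OF g] by blast
  then show ?thesis
    using Comp_assoc[OF to_terminal_in_hom[OF X] v(1) g]
      zero_mor_through_terminal[OF X Comp_in_hom[OF v(1) g]] by simp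
qed

lemma zero_mor_Comp:
  assumes f: "f \<in> hom C X Y" and Z: "Z \<in> Obj C"
  shows "zero_mor C Y Z \<cdot> f = zero_mor C X Z"
proof -
  obtain v where v: "v \<in> hom C (terminal C) Z" "zero_mor C Y Z = v \<cdot> to_terminal C Y"
    using zero_mor_factors Z hom_Obj(2)[OF f] by blast
  have t: "to_terminal C Y \<in> hom C Y (terminal C)"
    using to_terminal_in_hom hom_Obj(2)[OF f] by blast
  show ?thesis
    using Comp_assoc[OF f t v(1)] zero_mor_eq[OF zero_object_terminal Comp_in_hom[OF f t] v(1)] v(2)
    by simp
qed

lemma is_product_prd:
  assumes "X \<in> Obj C" "Y \<in> Obj C"
  shows "is_product C X Y (prd C X Y, proj1 C X Y, proj2 C X Y)"
proof -
  have "is_product C X Y (product_diagram C X Y)"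
    unfolding product_diagram_def using finite_products assms
    by (auto simp: has_finite_products_def intro: someI_ex)
  then show ?thesis by (simp add: prd_def proj1_def proj2_def)
qed

lemma prd_Obj: "X \<in> Obj C \<Longrightarrow> Y \<in> Obj C \<Longrightarrow> prd C X Y \<in> Obj C"
  and proj1_in_hom: "X \<in> Obj C \<Longrightarrow> Y \<in> Obj C \<Longrightarrow> proj1 C X Y \<in> hom C (prd C X Y) X"
  and proj2_in_hom: "X \<in> Obj C \<Longrightarrow> Y \<in> Obj C \<Longrightarrow> proj2 C X Y \<in> hom C (prd C X Y) Y"
  using is_product_prd by (auto simp: is_product_def)

lemma pairing_universal:
  assumes x: "x \<in> hom C S X" and y: "y \<in> hom C S Y"
  shows "\<exists>!h. h \<in> hom C S (prd C X Y) \<and> proj1 C X Y \<cdot> h = x \<and> proj2 C X Y \<cdot> h = y"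
  using is_product_prd[OF hom_Obj(2)[OF x] hom_Obj(2)[OF y]] x y hom_Obj(1)[OF x]
  unfolding is_product_def by blast

lemma pairing_props:
  assumes x: "x \<in> hom C S X" and y: "y \<in> hom C S Y"
  shows pairing_in_hom: "pairing C x y \<in> hom C S (prd C X Y)"
    and proj1_pairing: "proj1 C X Y \<cdot> pairing C x y = x"
    and proj2_pairing: "proj2 C X Y \<cdot> pairing C x y = y"
proof -
  have "Dom C x = S" "Cod C x = X" "Cod C y = Y" using x y by (auto simp: hom_def)
  then show "pairing C x y \<in> hom C S (prd C X Y)"
    and "proj1 C X Y \<cdot> pairing C x y = x" and "proj2 C X Y \<cdot> pairing C x y = y"
    using theI'[OF pairing_universal[OF x y]] by (auto simp: pairing_def)
qed

lemma pairing_eqI: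
  assumes h: "h \<in> hom C S (prd C X Y)"
    and x: "x \<in> hom C S X" "proj1 C X Y \<cdot> h = x" and y: "y \<in> hom C S Y" "proj2 C X Y \<cdot> h = y"
  shows "h = pairing C x y"
  using pairing_universal[OF x(1) y(1)] pairing_props[OF x(1) y(1)] h x y by blast

lemma pairing_Comp:
  assumes x: "x \<in> hom C S X" and y: "y \<in> hom C S Y" and k: "k \<in> hom C R S"
  shows "pairing C x y \<cdot> k = pairing C (x \<cdot> k) (y \<cdot> k)"
proof (rule pairing_eqI)
  have X: "X \<in> Obj C" and Y: "Y \<in> Obj C" using hom_Obj x y by auto
  note p = pairing_in_hom[OF x y]
  show "pairing C x y \<cdot> k \<in> hom C R (prd C X Y)" by (rule Comp_in_hom[OF k p])
  show "x \<cdot> k \<in> hom C R X" "y \<cdot> k \<in> hom C R Y" by (rule Comp_in_hom[OF k x] Comp_in_hom[OF k y])+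
  show "proj1 C X Y \<cdot> pairing C x y \<cdot> k = x \<cdot> k"
    using Comp_assoc[OF k p proj1_in_hom[OF X Y]] proj1_pairing[OF x y] by simp
  show "proj2 C X Y \<cdot> pairing C x y \<cdot> k = y \<cdot> k"
    using Comp_assoc[OF k p proj2_in_hom[OF X Y]] proj2_pairing[OF x y] by simp
qed

lemma Comp_pairing_Comp:
  assumes m: "m \<in> hom C (prd C X Y) Z"
    and x: "x \<in> hom C S X" and y: "y \<in> hom C S Y" and k: "k \<in> hom C R S"
  shows "(m \<cdot> pairing C x y) \<cdot> k = m \<cdot> pairing C (x \<cdot> k) (y \<cdot> k)"
  using Comp_assoc[OF k pairing_in_hom[OF x y] m] pairing_Comp[OF x y k] by simp

lemma pairing_proj1_proj2:
  assumes "X \<in> Obj C" "Y \<in> Obj C"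
  shows "pairing C (proj1 C X Y) (proj2 C X Y) = Ident C (prd C X Y)"
  using pairing_eqI[OF Ident_in_hom[OF prd_Obj[OF assms]]] assms
    proj1_in_hom proj2_in_hom Comp_Ident_right by metis


section \<open>Unital operations\<close>

definition unital_op :: "'a \<Rightarrow> 'b \<Rightarrow> bool" where
  "unital_op X \<rho> \<longleftrightarrow> X \<in> Obj C \<and> \<rho> \<in> hom C (prd C X X) X \<and>
     \<rho> \<cdot> pairing C (Ident C X) (zero_mor C X X) = Ident C X \<and>
     \<rho> \<cdot> pairing C (zero_mor C X X) (Ident C X) = Ident C X"

lemma commutative_object_iff_unital_op: "commutative_object C X \<longleftrightarrow> (\<exists>\<rho>. unital_op X \<rho>)"
  by (auto simp: commutative_object_def unital_op_def)

lemma unital_op_in_hom: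
  assumes "unital_op X \<rho>"
  shows "X \<in> Obj C" "\<rho> \<in> hom C (prd C X X) X"
  using assms by (auto simp: unital_op_def)

lemma unital_op_zero_right:
  assumes \<rho>: "unital_op X \<rho>" and x: "x \<in> hom C S X"
  shows "\<rho> \<cdot> pairing C x (zero_mor C S X) = x"
proof -
  have X: "X \<in> Obj C" and r: "\<rho> \<in> hom C (prd C X X) X"
    and u: "\<rho> \<cdot> pairing C (Ident C X) (zero_mor C X X) = Ident C X"
    using \<rho> by (auto simp: unital_op_def)
  show ?thesis
    using Comp_pairing_Comp[OF r Ident_in_hom[OF X] zero_mor_in_hom[OF X X] x] u
    by (simp add: Comp_Ident_left[OF x] zero_mor_Comp[OF x X])
qed

lemma unital_op_zero_left:
  assumes \<rho>: "unital_op X \<rho>" and x: "x \<in> hom C S X"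
  shows "\<rho> \<cdot> pairing C (zero_mor C S X) x = x"
proof -
  have X: "X \<in> Obj C" and r: "\<rho> \<in> hom C (prd C X X) X"
    and u: "\<rho> \<cdot> pairing C (zero_mor C X X) (Ident C X) = Ident C X"
    using \<rho> by (auto simp: unital_op_def)
  show ?thesis
    using Comp_pairing_Comp[OF r zero_mor_in_hom[OF X X] Ident_in_hom[OF X] x] u
    by (simp add: Comp_Ident_left[OF x] zero_mor_Comp[OF x X])
qed

lemma unital_op_swap:
  assumes \<rho>: "unital_op X \<rho>"
  shows "unital_op X (\<rho> \<cdot> pairing C (proj2 C X X) (proj1 C X X))"
proof -
  note X = unital_op_in_hom(1)[OF \<rho>] and r = unital_op_in_hom(2)[OF \<rho>]
  note p = proj1_in_hom[OF X X] and q = proj2_in_hom[OF X X]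
  note I = Ident_in_hom[OF X] and O = zero_mor_in_hom[OF X X]
  have "(\<rho> \<cdot> pairing C (proj2 C X X) (proj1 C X X)) \<cdot> pairing C x y = \<rho> \<cdot> pairing C y x"
    if "x \<in> hom C X X" "y \<in> hom C X X" for x y
    using Comp_pairing_Comp[OF r q p pairing_in_hom[OF that]]
    by (simp add: proj1_pairing[OF that] proj2_pairing[OF that])
  then show ?thesis
    using \<rho> I O Comp_in_hom[OF pairing_in_hom[OF q p] r] by (simp add: unital_op_def)
qed

end


section \<open>Rigidity of unital operations in a centralic category\<close>

locale centralic_category = pointed_category_with_products +
  assumes centralic: "centralic C"
begin

lemma centralicD:
  assumes f: "f \<in> hom C (prd C X Y) Z"
    and x: "x \<in> hom C S X" "x' \<in> hom C S X" and y: "y \<in> hom C S Y"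
    and "f \<cdot> pairing C x (zero_mor C S Y) = f \<cdot> pairing C x' (zero_mor C S Y)"
  shows "f \<cdot> pairing C x y = f \<cdot> pairing C x' y"
  using centralic assms hom_Obj[OF x(1)] hom_Obj[OF y] hom_Obj[OF f]
  unfolding centralic_def by blast

text \<open>
  Both sides arise from \<open>h((u, a), c) = \<sigma>(u, f(\<rho>(a, c)))\<close>: the right-hand side is the value of
  \<open>h\<close> at \<open>((\<sigma>(u, f(a)), 0), c)\<close>.  By the unit laws the two values coincide at \<open>c = 0\<close>, where both
  are \<open>\<sigma>(u, f(a))\<close>, so they coincide at every \<open>c\<close> by the centralic axiom.
\<close>

lemma mixed_associativity:
  assumes \<rho>: "unital_op X \<rho>" and \<sigma>: "unital_op Y \<sigma>" and f: "f \<in> hom C X Y"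
    and u: "u \<in> hom C S Y" and a: "a \<in> hom C S X" and c: "c \<in> hom C S X"
  shows "\<sigma> \<cdot> pairing C u (f \<cdot> \<rho> \<cdot> pairing C a c) =
    \<sigma> \<cdot> pairing C (\<sigma> \<cdot> pairing C u (f \<cdot> a)) (f \<cdot> c)"
proof -
  note X = unital_op_in_hom(1)[OF \<rho>] and r = unital_op_in_hom(2)[OF \<rho>]
  note Y = unital_op_in_hom(1)[OF \<sigma>] and s = unital_op_in_hom(2)[OF \<sigma>]
  have S: "S \<in> Obj C" using hom_Obj u by blast
  let ?YX = "prd C Y X" and ?P = "prd C (prd C Y X) X"
  let ?p = "proj1 C ?YX X" and ?\<pi>u = "proj1 C Y X \<cdot> proj1 C ?YX X"
    and ?\<pi>a = "proj2 C Y X \<cdot> proj1 C ?YX X" and ?\<pi>c = "proj2 C ?YX X"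
  define h where "h = \<sigma> \<cdot> pairing C ?\<pi>u (f \<cdot> \<rho> \<cdot> pairing C ?\<pi>a ?\<pi>c)"
  have YX: "?YX \<in> Obj C" using prd_Obj[OF Y X] .
  have p: "?p \<in> hom C ?P ?YX" and \<pi>c: "?\<pi>c \<in> hom C ?P X"
    using proj1_in_hom[OF YX X] proj2_in_hom[OF YX X] .
  have \<pi>u: "?\<pi>u \<in> hom C ?P Y" and \<pi>a: "?\<pi>a \<in> hom C ?P X"
    using Comp_in_hom[OF p proj1_in_hom[OF Y X]] Comp_in_hom[OF p proj2_in_hom[OF Y X]] .
  have r': "\<rho> \<cdot> pairing C ?\<pi>a ?\<pi>c \<in> hom C ?P X"
    by (rule Comp_in_hom[OF pairing_in_hom[OF \<pi>a \<pi>c] r])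
  have fr: "f \<cdot> \<rho> \<cdot> pairing C ?\<pi>a ?\<pi>c \<in> hom C ?P Y" by (rule Comp_in_hom[OF r' f])
  have h: "h \<in> hom C ?P Y"
    unfolding h_def by (rule Comp_in_hom[OF pairing_in_hom[OF \<pi>u fr] s])
  have h_apply: "h \<cdot> pairing C (pairing C v b) d = \<sigma> \<cdot> pairing C v (f \<cdot> \<rho> \<cdot> pairing C b d)"
    if v: "v \<in> hom C S Y" and b: "b \<in> hom C S X" and d: "d \<in> hom C S X" for v b d
  proof -
    let ?k = "pairing C (pairing C v b) d"
    note vb = pairing_in_hom[OF v b]
    note k = pairing_in_hom[OF vb d]
    have "?\<pi>u \<cdot> ?k = v" "?\<pi>a \<cdot> ?k = b" "?\<pi>c \<cdot> ?k = d"
      using Comp_assoc[OF k p proj1_in_hom[OF Y X]] Comp_assoc[OF k p proj2_in_hom[OF Y X]]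
      by (simp_all add: proj1_pairing[OF vb d] proj2_pairing[OF vb d]
          proj1_pairing[OF v b] proj2_pairing[OF v b])
    moreover have "(f \<cdot> \<rho> \<cdot> pairing C ?\<pi>a ?\<pi>c) \<cdot> ?k =
        f \<cdot> \<rho> \<cdot> pairing C (?\<pi>a \<cdot> ?k) (?\<pi>c \<cdot> ?k)"
      using Comp_assoc[OF k r' f] Comp_pairing_Comp[OF r \<pi>a \<pi>c k] by simp
    ultimately show ?thesis
      unfolding h_def using Comp_pairing_Comp[OF s \<pi>u fr k] by simp
  qed
  let ?w = "\<sigma> \<cdot> pairing C u (f \<cdot> a)"
  note fa = Comp_in_hom[OF a f] and O = zero_mor_in_hom[OF S X]
  have w: "?w \<in> hom C S Y" by (rule Comp_in_hom[OF pairing_in_hom[OF u fa] s])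
  have "h \<cdot> pairing C (pairing C u a) (zero_mor C S X) =
      h \<cdot> pairing C (pairing C ?w (zero_mor C S X)) (zero_mor C S X)"
    by (simp add: h_apply[OF u a O] h_apply[OF w O O] unital_op_zero_right[OF \<rho> a]
        unital_op_zero_right[OF \<rho> O] Comp_zero_mor[OF S f] unital_op_zero_right[OF \<sigma> w])
  from centralicD[OF h pairing_in_hom[OF u a] pairing_in_hom[OF w O] c this]
  show ?thesis
    by (simp add: h_apply[OF u a c] h_apply[OF w O c] unital_op_zero_left[OF \<rho> c])
qed

text \<open>Put \<open>u = 0\<close> in mixed associativity and let \<open>a\<close>, \<open>c\<close> be the two projections.\<close>

lemma unital_op_preserved:
  assumes \<rho>: "unital_op X \<rho>" and \<sigma>: "unital_op Y \<sigma>" and f: "f \<in> hom C X Y"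
  shows "f \<cdot> \<rho> = \<sigma> \<cdot> pairing C (f \<cdot> proj1 C X X) (f \<cdot> proj2 C X X)"
proof -
  note X = unital_op_in_hom(1)[OF \<rho>] and r = unital_op_in_hom(2)[OF \<rho>]
  note Y = unital_op_in_hom(1)[OF \<sigma>]
  note p = proj1_in_hom[OF X X] and q = proj2_in_hom[OF X X]
  have "\<rho> \<cdot> pairing C (proj1 C X X) (proj2 C X X) = \<rho>"
    using pairing_proj1_proj2[OF X X] Comp_Ident_right[OF r] by simp
  then show ?thesis
    using mixed_associativity[OF \<rho> \<sigma> f zero_mor_in_hom[OF prd_Obj[OF X X] Y] p q]
    by (simp add: unital_op_zero_left[OF \<sigma> Comp_in_hom[OF r f]]
        unital_op_zero_left[OF \<sigma> Comp_in_hom[OF p f]])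
qed

text \<open>
  The identity is a morphism from \<open>X\<close> with \<open>\<rho>\<close> to \<open>X\<close> with \<open>\<sigma>\<close>; that it preserves the
  operations means that they are equal.
\<close>

lemma unital_op_unique:
  assumes \<rho>: "unital_op X \<rho>" and \<sigma>: "unital_op X \<sigma>"
  shows "\<rho> = \<sigma>"
proof -
  note X = unital_op_in_hom(1)[OF \<rho>]
  show ?thesis
    using unital_op_preserved[OF \<rho> \<sigma> Ident_in_hom[OF X]]
    by (simp add: Comp_Ident_left[OF unital_op_in_hom(2)[OF \<rho>]]
        Comp_Ident_left[OF proj1_in_hom[OF X X]] Comp_Ident_left[OF proj2_in_hom[OF X X]]
        pairing_proj1_proj2[OF X X] Comp_Ident_right[OF unital_op_in_hom(2)[OF \<sigma>]])
qed

text \<open>Swapping the arguments yields a unital operation again, and there is only one.\<close>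

lemma unital_op_commutative:
  assumes "unital_op X \<rho>"
  shows "\<rho> \<cdot> pairing C (proj2 C X X) (proj1 C X X) = \<rho>"
  by (rule unital_op_unique[OF unital_op_swap[OF assms] assms])

lemma unital_op_associative:
  assumes \<rho>: "unital_op X \<rho>"
    and a: "a \<in> hom C S X" and b: "b \<in> hom C S X" and c: "c \<in> hom C S X"
  shows "\<rho> \<cdot> pairing C (\<rho> \<cdot> pairing C a b) c = \<rho> \<cdot> pairing C a (\<rho> \<cdot> pairing C b c)"
  using mixed_associativity[OF \<rho> \<rho> Ident_in_hom[OF unital_op_in_hom(1)[OF \<rho>]] a b c]
  by (simp add: Comp_Ident_left[OF Comp_in_hom[OF pairing_in_hom[OF b c] unital_op_in_hom(2)[OF \<rho>]]]
      Comp_Ident_left[OF b] Comp_Ident_left[OF c])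

text \<open>
  The unit of an internal monoid is forced, because the terminal object is a zero object; the
  unit laws of the monoid are then the two unit laws of a unital operation.
\<close>

lemma internal_comm_monoid_iff_unital_op:
  "internal_comm_monoid C (X, m, e) \<longleftrightarrow> unital_op X m \<and> e = zero_mor C (terminal C) X"
proof
  assume M: "internal_comm_monoid C (X, m, e)"
  then have X: "X \<in> Obj C" and e: "e \<in> hom C (terminal C) X"
    by (auto simp: internal_comm_monoid_def)
  have "e \<cdot> to_terminal C X = zero_mor C X X" by (rule zero_mor_through_terminal[OF X e])
  then show "unital_op X m \<and> e = zero_mor C (terminal C) X"
    using M hom_terminal_eq_zero_mor[OF e]
    by (auto simp: internal_comm_monoid_def unital_op_def)
next
  assume "unital_op X m \<and> e = zero_mor C (terminal C) X"
  then have m: "unital_op X m" and e: "e = zero_mor C (terminal C) X" by auto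
  note X = unital_op_in_hom(1)[OF m]
  have T: "terminal C \<in> Obj C"
    using terminal_object_terminal by (simp add: terminal_object_def)
  have e_hom: "e \<in> hom C (terminal C) X" using zero_mor_in_hom[OF T X] e by simp
  have e0: "e \<cdot> to_terminal C X = zero_mor C X X" by (rule zero_mor_through_terminal[OF X e_hom])
  note XX = prd_Obj[OF X X]
  note p = proj1_in_hom[OF XX X]
  note assoc = unital_op_associative[OF m Comp_in_hom[OF p proj1_in_hom[OF X X]]
      Comp_in_hom[OF p proj2_in_hom[OF X X]] proj2_in_hom[OF XX X]]
  show "internal_comm_monoid C (X, m, e)"
    using m e_hom assoc unital_op_commutative[OF m]
    by (simp add: internal_comm_monoid_def unital_op_def Let_def e0)
qed

text \<open>
  The multiplications are unital operations and the units are zero morphisms; every morphism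
  preserves both.
\<close>

lemma internal_monoid_hom_iff_hom:
  assumes M: "internal_comm_monoid C (X, m, e)" and N: "internal_comm_monoid C (Y, n, u)"
  shows "internal_monoid_hom C (X, m, e) (Y, n, u) f \<longleftrightarrow> f \<in> hom C X Y"
proof -
  have T: "terminal C \<in> Obj C"
    using terminal_object_terminal by (simp add: terminal_object_def)
  show ?thesis
    using M N unital_op_preserved Comp_zero_mor[OF T]
    by (auto simp: internal_monoid_hom_def internal_comm_monoid_iff_unital_op)
qed


section \<open>The two inverse functors\<close>

lemma hom_Com:
  "hom (Com C) X Y = (if commutative_object C X \<and> commutative_object C Y then hom C X Y else {})"
  by (auto simp: hom_def Com_def full_subcategory_def)

lemma Com_simps:
  "Obj (Com C) = {X. commutative_object C X}" "Ident (Com C) = Ident C" "Comp (Com C) = Comp C"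
  by (auto simp: Com_def full_subcategory_def commutative_object_def)

lemma category_Com: "category (Com C)"
proof
  show "Dom (Com C) f \<in> Obj (Com C)" "Cod (Com C) f \<in> Obj (Com C)" if "f \<in> Arr (Com C)" for f
    using that Dom_in_Obj Cod_in_Obj by (auto simp: Com_def full_subcategory_def)
  show "Ident (Com C) X \<in> hom (Com C) X X" if "X \<in> Obj (Com C)" for X
    using that Ident_in_hom by (simp add: hom_Com Com_simps commutative_object_def)
  show "g \<cdot>\<^bsub>Com C\<^esub> f \<in> hom (Com C) X Z"
    if "f \<in> hom (Com C) X Y" "g \<in> hom (Com C) Y Z" for f g X Y Z
    using that Comp_in_hom by (auto simp: hom_Com Com_simps split: if_splits)
  show "(h \<cdot>\<^bsub>Com C\<^esub> g) \<cdot>\<^bsub>Com C\<^esub> f = h \<cdot>\<^bsub>Com C\<^esub> (g \<cdot>\<^bsub>Com C\<^esub> f)"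
    if "f \<in> hom (Com C) W X" "g \<in> hom (Com C) X Y" "h \<in> hom (Com C) Y Z" for f g h W X Y Z
    using that Comp_assoc by (auto simp: hom_Com Com_simps split: if_splits)
  show "f \<cdot>\<^bsub>Com C\<^esub> Ident (Com C) X = f" "Ident (Com C) Y \<cdot>\<^bsub>Com C\<^esub> f = f"
    if "f \<in> hom (Com C) X Y" for f X Y
    using that Comp_Ident_left Comp_Ident_right by (auto simp: hom_Com Com_simps split: if_splits)
qed

lemma hom_CMon:
  "F \<in> hom (CMon C) M N \<longleftrightarrow> internal_comm_monoid C M \<and> internal_comm_monoid C N \<and>
     (\<exists>f \<in> hom C (fst M) (fst N). F = (M, f, N))"
  using internal_monoid_hom_iff_hom
  by (cases M; cases N) (auto simp: hom_def CMon_def)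

lemma CMon_simps:
  "Obj (CMon C) = {M. internal_comm_monoid C M}" "Ident (CMon C) M = (M, Ident C (fst M), M)"
  "Comp (CMon C) (M', g, N') (M, f, N) = (M, g \<cdot> f, N')"
  by (auto simp: CMon_def)

lemma internal_comm_monoid_Obj: "internal_comm_monoid C M \<Longrightarrow> fst M \<in> Obj C"
  by (auto simp: internal_comm_monoid_def)

lemma category_CMon: "category (CMon C)"
proof
  show "Dom (CMon C) F \<in> Obj (CMon C)" "Cod (CMon C) F \<in> Obj (CMon C)"
    if "F \<in> Arr (CMon C)" for F
    using that by (auto simp: CMon_def)
  show "Ident (CMon C) M \<in> hom (CMon C) M M" if "M \<in> Obj (CMon C)" for M
    using that Ident_in_hom internal_comm_monoid_Obj by (auto simp: hom_CMon CMon_simps)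
  show "G \<cdot>\<^bsub>CMon C\<^esub> F \<in> hom (CMon C) M L"
    if F: "F \<in> hom (CMon C) M N" and G: "G \<in> hom (CMon C) N L" for F G M N L
  proof -
    from F obtain f where "f \<in> hom C (fst M) (fst N)" "F = (M, f, N)" by (auto simp: hom_CMon)
    moreover from G obtain g where "g \<in> hom C (fst N) (fst L)" "G = (N, g, L)"
      by (auto simp: hom_CMon)
    ultimately show ?thesis using F G Comp_in_hom by (simp add: hom_CMon CMon_simps)
  qed
  show "(H \<cdot>\<^bsub>CMon C\<^esub> G) \<cdot>\<^bsub>CMon C\<^esub> F = H \<cdot>\<^bsub>CMon C\<^esub> (G \<cdot>\<^bsub>CMon C\<^esub> F)"
    if F: "F \<in> hom (CMon C) K L" and G: "G \<in> hom (CMon C) L M" and H: "H \<in> hom (CMon C) M N"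
    for F G H K L M N
  proof -
    from F obtain f where f: "f \<in> hom C (fst K) (fst L)" "F = (K, f, L)" by (auto simp: hom_CMon)
    from G obtain g where g: "g \<in> hom C (fst L) (fst M)" "G = (L, g, M)" by (auto simp: hom_CMon)
    from H obtain h where h: "h \<in> hom C (fst M) (fst N)" "H = (M, h, N)" by (auto simp: hom_CMon)
    show ?thesis using Comp_assoc[OF f(1) g(1) h(1)] by (simp add: f(2) g(2) h(2) CMon_simps)
  qed
  show "F \<cdot>\<^bsub>CMon C\<^esub> Ident (CMon C) M = F" "Ident (CMon C) N \<cdot>\<^bsub>CMon C\<^esub> F = F"
    if F: "F \<in> hom (CMon C) M N" for F M N
  proof -
    from F obtain f where f: "f \<in> hom C (fst M) (fst N)" "F = (M, f, N)" by (auto simp: hom_CMon)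
    show "F \<cdot>\<^bsub>CMon C\<^esub> Ident (CMon C) M = F" "Ident (CMon C) N \<cdot>\<^bsub>CMon C\<^esub> F = F"
      using Comp_Ident_left[OF f(1)] Comp_Ident_right[OF f(1)] by (simp_all add: f(2) CMon_simps)
  qed
qed

text \<open>
  On a commutative object the description is proper, since the unital operation is unique.
\<close>

definition canonical_monoid :: "'a \<Rightarrow> 'a \<times> 'b \<times> 'b" where
  "canonical_monoid X = (X, THE \<rho>. unital_op X \<rho>, zero_mor C (terminal C) X)"

lemma fst_canonical_monoid: "fst (canonical_monoid X) = X"
  by (simp add: canonical_monoid_def)

lemma the_unital_op: "unital_op X \<rho> \<Longrightarrow> (THE \<rho>. unital_op X \<rho>) = \<rho>"
  using unital_op_unique by blast

lemma internal_comm_monoid_canonical: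
  "commutative_object C X \<Longrightarrow> internal_comm_monoid C (canonical_monoid X)"
  by (auto simp: commutative_object_iff_unital_op canonical_monoid_def
      internal_comm_monoid_iff_unital_op the_unital_op)

lemma commutative_object_fst: "internal_comm_monoid C M \<Longrightarrow> commutative_object C (fst M)"
  by (cases M) (auto simp: commutative_object_iff_unital_op internal_comm_monoid_iff_unital_op)

lemma canonical_monoid_fst: "internal_comm_monoid C M \<Longrightarrow> canonical_monoid (fst M) = M"
  by (cases M) (auto simp: canonical_monoid_def internal_comm_monoid_iff_unital_op the_unital_op)

definition canonical_structure ::
    "('a, 'b, 'a \<times> 'b \<times> 'b, ('a \<times> 'b \<times> 'b) \<times> 'b \<times> ('a \<times> 'b \<times> 'b)) fctor" where
  "canonical_structure = \<lparr>OMap = canonical_monoid,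
     AMap = (\<lambda>f. (canonical_monoid (Dom C f), f, canonical_monoid (Cod C f)))\<rparr>"

definition forget_structure ::
    "('a \<times> 'b \<times> 'b, ('a \<times> 'b \<times> 'b) \<times> 'b \<times> ('a \<times> 'b \<times> 'b), 'a, 'b) fctor" where
  "forget_structure = \<lparr>OMap = fst, AMap = (\<lambda>(M, f, N). f)\<rparr>"

lemma OMap_canonical_structure: "OMap canonical_structure = canonical_monoid"
  by (simp add: canonical_structure_def)

lemma AMap_canonical_structure:
  "f \<in> hom C X Y \<Longrightarrow> AMap canonical_structure f = (canonical_monoid X, f, canonical_monoid Y)"
  by (auto simp: canonical_structure_def hom_def)

lemma is_functor_canonical_structure: "is_functor (Com C) (CMon C) canonical_structure"
  unfolding is_functor_def
proof (intro conjI ballI)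
  show "category (Com C)" "category (CMon C)" by (rule category_Com category_CMon)+
  show "OMap canonical_structure X \<in> Obj (CMon C)" if "X \<in> Obj (Com C)" for X
    using that by (simp add: Com_simps CMon_simps canonical_structure_def internal_comm_monoid_canonical)
  show "AMap canonical_structure f \<in> hom (CMon C) (OMap canonical_structure X) (OMap canonical_structure Y)"
    if "f \<in> hom (Com C) X Y" for X Y f
    using that
    by (auto simp: hom_Com hom_CMon AMap_canonical_structure OMap_canonical_structure
        internal_comm_monoid_canonical fst_canonical_monoid split: if_splits)
  show "AMap canonical_structure (Ident (Com C) X) = Ident (CMon C) (OMap canonical_structure X)"
    if "X \<in> Obj (Com C)" for X
    using that AMap_canonical_structure[OF Ident_in_hom]
    by (simp add: Com_simps CMon_simps commutative_object_def fst_canonical_monoid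
        OMap_canonical_structure)
  show "AMap canonical_structure (g \<cdot>\<^bsub>Com C\<^esub> f) = AMap canonical_structure g \<cdot>\<^bsub>CMon C\<^esub> AMap canonical_structure f"
    if "f \<in> hom (Com C) X Y" "g \<in> hom (Com C) Y Z" for X Y Z f g
    using that AMap_canonical_structure[OF Comp_in_hom]
    by (auto simp: hom_Com Com_simps CMon_simps AMap_canonical_structure split: if_splits)
qed

lemma is_functor_forget_structure: "is_functor (CMon C) (Com C) forget_structure"
  unfolding is_functor_def using category_Com category_CMon
  by (auto simp: forget_structure_def hom_Com hom_CMon Com_simps CMon_simps
      commutative_object_fst simp del: split_paired_All split_paired_Ex)

lemma equivalent_Com_CMon: "equivalent_categories (Com C) (CMon C)"
  unfolding equivalent_categories_def
proof (intro exI conjI)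
  note F = is_functor_canonical_structure and G = is_functor_forget_structure
  show "is_functor (Com C) (CMon C) canonical_structure" "is_functor (CMon C) (Com C) forget_structure"
    by (rule F G)+
  show "naturally_isomorphic (Com C) (Com C) (comp_functor forget_structure canonical_structure)
      id_functor"
    by (rule naturally_isomorphic_id[OF is_functor_comp[OF F G]])
      (auto simp: comp_functor_def canonical_structure_def forget_structure_def fst_canonical_monoid)
  show "naturally_isomorphic (CMon C) (CMon C) (comp_functor canonical_structure forget_structure)
      id_functor"
  proof (rule naturally_isomorphic_id[OF is_functor_comp[OF G F]])
    show "OMap (comp_functor canonical_structure forget_structure) M = M" if "M \<in> Obj (CMon C)" for M
      using that by (simp add: comp_functor_def canonical_structure_def forget_structure_def
          CMon_simps canonical_monoid_fst)
    show "AMap (comp_functor canonical_structure forget_structure) \<phi> = \<phi>"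
      if "\<phi> \<in> hom (CMon C) M N" for \<phi> M N
      using that AMap_canonical_structure
      by (auto simp: hom_CMon comp_functor_def forget_structure_def canonical_monoid_fst
          simp del: split_paired_All split_paired_Ex)
  qed
qed

end

theorem corollary3p15:
  fixes C :: "('o, 'm) cat"
  assumes "centralic C"
  shows "equivalent_categories (Com C) (CMon C)"
proof -
  have C: "pointed C" "has_finite_products C" using assms unfolding centralic_def by blast+
  interpret category C using C(1) by (simp add: pointed_def)
  interpret centralic_category C by unfold_locales (rule C assms)+
  show ?thesis by (rule equivalent_Com_CMon)
qed

end
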